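(* Let $n\ge 2$ and let $k,\ell\ge 0$ be integers. Then $$\mathrm{Dist}_n(k,\ell)=\sum_{\pi\in\Pi_k}\mathrm{IP}_\pi(\ell),$$ where $\mathrm{Dist}_n(k,\ell)$ is the coefficient of $q^k t^\ell$ in the two-variable distance enumerator $D_{\mathcal S_n}(q,t)$ of the Shi arrangement, $\Pi_k$ is the set of permutations of $\{1,\dots,n\}$ with exactly $k$ non-inversions, and $\mathrm{IP}_\pi(\ell)$ is the number of order ideals with exactly $\binom n2-k-\ell$ elements in the inversion poset $\mathrm{IP}_\pi$ of $\pi$.
   Context: The Shi arrangement $\mathcal S_n$ in $\mathbb R^n$ consists of the hyperplanes $x_i-x_j=0$ and $x_i-x_j=1$ for $1\le i<j\le n$. Its regions are the connected components of the complement in $\mathbb R^n$ of the union of the hyperplanes; $\mathcal R(\mathcal S_n)$ is the set of regions. The base region $B$ is the region $x_1>x_2>\cdots>x_n>x_1-1$. For a region $R$, let $a(R)$ be the number of hyperplanes of the form $x_i-x_j=0$ ($i<j$) separating $R$ from $B$, and $b(R)$ the number of hyperplanes of the form $x_i-x_j=1$ ($i<j$) separating $R$ from $B$. Define $D_{\mathcal S_n}(q,t)=\sum_{R\in\mathcal R(\mathcal S_n)}q^{a(R)}t^{b(R)}$. A permutation $\pi=(\pi_1,\dots,\pi_n)$ of $\{1,\dots,n\}$ is written in one-line notation. An inversion of $\pi$ is a pair $(\pi_i,\pi_j)$ with $i<j$ and $\pi_i>\pi_j$; a non-inversion is a pair $(\pi_i,\pi_j)$ with $i<j$ and $\pi_i<\pi_j$.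 The inversion poset $\mathrm{IP}_\pi$ has as elements the inversions of $\pi$, ordered by containment of positions: for inversions $g=(\pi_i,\pi_j)$ with $i<j$ and $h=(\pi_a,\pi_b)$ with $a<b$, $g\le h$ iff $a\le i<j\le b$. An (order) ideal is a downward closed subset; the number of ideals with a negative number of elements is $0$. *)

theory Defs
  imports "HOL-Analysis.Analysis" "HOL-Computational_Algebra.Polynomial"
    "HOL-Combinatorics.Permutations"
begin

text \<open>
  Since $n$ is a variable, $\mathbb{R}^n$ is taken as the product topology on real-valued functions
  on the index set \<open>{1..n}\<close> (extended by \<open>undefined\<close> outside of it).
\<close>

abbreviation Rn :: "nat \<Rightarrow> (nat \<Rightarrow> real) topology" where
  "Rn n \<equiv> powertop_real {1..n}"

definition diff_hyperplane :: "nat \<Rightarrow> nat \<Rightarrow> nat \<Rightarrow> real \<Rightarrow> (nat \<Rightarrow> real) set" where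
  "diff_hyperplane n i j c = {x \<in> topspace (Rn n). x i - x j = c}"

definition diff_hyperplanes :: "nat \<Rightarrow> real \<Rightarrow> (nat \<Rightarrow> real) set set" where
  "diff_hyperplanes n c = {diff_hyperplane n i j c | i j. 1 \<le> i \<and> i < j \<and> j \<le> n}"

definition shi_arrangement :: "nat \<Rightarrow> (nat \<Rightarrow> real) set set" where
  "shi_arrangement n = diff_hyperplanes n 0 \<union> diff_hyperplanes n 1"

definition regions :: "nat \<Rightarrow> (nat \<Rightarrow> real) set set \<Rightarrow> (nat \<Rightarrow> real) set set" where
  "regions n \<A> = connected_components_of (subtopology (Rn n) (topspace (Rn n) - \<Union>\<A>))"

definition base_region :: "nat \<Rightarrow> (nat \<Rightarrow> real) set" where
  "base_region n =
    {x \<in> topspace (Rn n). (\<forall>i\<in>{1..<n}. x i > x (Suc i)) \<and> x n > x 1 - 1}"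

text \<open>
  The regions of a one-hyperplane arrangement \<open>{H}\<close> are the two open sides of \<open>H\<close>; so \<open>H\<close> separates
  two sets if they lie on different sides of it.
\<close>

definition separates ::
    "nat \<Rightarrow> (nat \<Rightarrow> real) set \<Rightarrow> (nat \<Rightarrow> real) set \<Rightarrow> (nat \<Rightarrow> real) set \<Rightarrow> bool" where
  "separates n H R S \<longleftrightarrow>
    (\<exists>C\<in>regions n {H}. \<exists>C'\<in>regions n {H}. C \<noteq> C' \<and> R \<subseteq> C \<and> S \<subseteq> C')"

definition dist_a :: "nat \<Rightarrow> (nat \<Rightarrow> real) set \<Rightarrow> nat" where
  "dist_a n R = card {H \<in> diff_hyperplanes n 0. separates n H R (base_region n)}"

definition dist_b :: "nat \<Rightarrow> (nat \<Rightarrow> real) set \<Rightarrow> nat" where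
  "dist_b n R = card {H \<in> diff_hyperplanes n 1. separates n H R (base_region n)}"

text \<open>
  Bivariate polynomials are polynomials in $q$ (outer variable) whose coefficients are
  polynomials in $t$ (inner variable); \<open>monom (monom 1 b) a\<close> is $q^a t^b$.
\<close>

definition distance_enumerator :: "nat \<Rightarrow> nat poly poly" where
  "distance_enumerator n =
    (\<Sum>R\<in>regions n (shi_arrangement n). monom (monom 1 (dist_b n R)) (dist_a n R))"

definition Dist :: "nat \<Rightarrow> nat \<Rightarrow> nat \<Rightarrow> nat" where
  "Dist n k l = coeff (coeff (distance_enumerator n) k) l"

text \<open>
  A permutation \<open>\<pi>\<close> of \<open>{1..n}\<close> is a function with \<open>\<pi> permutes {1..n}\<close>, whose one-line notation is
  \<open>(\<pi> 1, \<dots>, \<pi> n)\<close>. Inversions and non-inversions are pairs of values, not of positions.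
\<close>

definition perm_inversions :: "nat \<Rightarrow> (nat \<Rightarrow> nat) \<Rightarrow> (nat \<times> nat) set" where
  "perm_inversions n \<pi> = {(\<pi> i, \<pi> j) | i j. 1 \<le> i \<and> i < j \<and> j \<le> n \<and> \<pi> i > \<pi> j}"

definition perm_noninversions :: "nat \<Rightarrow> (nat \<Rightarrow> nat) \<Rightarrow> (nat \<times> nat) set" where
  "perm_noninversions n \<pi> = {(\<pi> i, \<pi> j) | i j. 1 \<le> i \<and> i < j \<and> j \<le> n \<and> \<pi> i < \<pi> j}"

definition perms_with_noninversions :: "nat \<Rightarrow> nat \<Rightarrow> (nat \<Rightarrow> nat) set" where
  "perms_with_noninversions n k =
    {\<pi>. \<pi> permutes {1..n} \<and> card (perm_noninversions n \<pi>) = k}"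

definition IP_le :: "nat \<Rightarrow> (nat \<Rightarrow> nat) \<Rightarrow> nat \<times> nat \<Rightarrow> nat \<times> nat \<Rightarrow> bool" where
  "IP_le n \<pi> g h \<longleftrightarrow>
    (\<exists>i j a b. {i, j, a, b} \<subseteq> {1..n} \<and> g = (\<pi> i, \<pi> j) \<and> h = (\<pi> a, \<pi> b) \<and>
      a \<le> i \<and> i < j \<and> j \<le> b)"

definition IP_ideal :: "nat \<Rightarrow> (nat \<Rightarrow> nat) \<Rightarrow> (nat \<times> nat) set \<Rightarrow> bool" where
  "IP_ideal n \<pi> I \<longleftrightarrow> I \<subseteq> perm_inversions n \<pi> \<and>
    (\<forall>h\<in>I. \<forall>g\<in>perm_inversions n \<pi>. IP_le n \<pi> g h \<longrightarrow> g \<in> I)"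

text \<open>The size is an integer, so that there are no ideals when it is negative.\<close>

definition num_IP_ideals :: "nat \<Rightarrow> (nat \<Rightarrow> nat) \<Rightarrow> int \<Rightarrow> nat" where
  "num_IP_ideals n \<pi> m = card {I. IP_ideal n \<pi> I \<and> int (card I) = m}"

end

theory Submission
  imports Defs
begin

text \<open>
  A region of the Shi arrangement is determined by the side of each hyperplane on which it lies.
  For a point \<open>x\<close> off the hyperplanes let \<open>\<pi>\<close> be the permutation with
  \<open>x (\<pi> 1) < \<dots> < x (\<pi> n)\<close>, and let \<open>I\<close> be the set of inversions \<open>(u, v)\<close> of \<open>\<pi>\<close> with
  \<open>x v - x u < 1\<close>. Since \<open>x\<close> increases along \<open>\<pi>\<close>, the set \<open>I\<close> is an ideal, and the pair \<open>(\<pi>, I)\<close>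
  carries the same information as the region of \<open>x\<close>. The non-inversions of \<open>\<pi>\<close> are the
  hyperplanes \<open>x i - x j = 0\<close> separating the region from the base region, and the inversions
  outside \<open>I\<close> are the separating hyperplanes \<open>x i - x j = 1\<close>. Conversely every pair \<open>(\<pi>, I)\<close>
  arises: the smallest choice of intervals of positions longer than 1 that is compatible with \<open>I\<close>
  is realized by placing the points greedily from left to right.
\<close>

subsection \<open>Regions as sign classes\<close>

text \<open>A triple \<open>(i, j, c)\<close> stands for the hyperplane
  \<open>x i - x j = c\<close>. The set \<open>T\<close> stays arbitrary so that one description of
  regions serves both the Shi arrangement and the one-hyperplane arrangements inside
  \<open>separates\<close>.\<close>

definition generic :: "nat \<Rightarrow> (nat \<times> nat \<times> real) set \<Rightarrow> (nat \<Rightarrow> real) set" where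
  "generic n T = {x \<in> topspace (Rn n). \<forall>(i, j, c)\<in>T. x i - x j \<noteq> c}"

text \<open>Comparing only \<open><\<close> loses nothing on generic points, where the alternative
  is \<open>>\<close>.\<close>

definition same_side :: "(nat \<times> nat \<times> real) set \<Rightarrow> (nat \<Rightarrow> real) \<Rightarrow> (nat \<Rightarrow> real) \<Rightarrow> bool" where
  "same_side T x y \<longleftrightarrow> (\<forall>(i, j, c)\<in>T. x i - x j < c \<longleftrightarrow> y i - y j < c)"

definition cell :: "nat \<Rightarrow> (nat \<times> nat \<times> real) set \<Rightarrow> (nat \<Rightarrow> real) \<Rightarrow> (nat \<Rightarrow> real) set" where
  "cell n T x = {y \<in> generic n T. same_side T x y}"

lemma cell_self: "x \<in> generic n T \<Longrightarrow> x \<in> cell n T x"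
  by (simp add: cell_def same_side_def)

lemma cell_eqI: "same_side T x y \<Longrightarrow> cell n T x = cell n T y"
  by (auto simp: cell_def same_side_def)

lemma cell_eq_iff:
  assumes "x \<in> generic n T" "y \<in> generic n T"
  shows "cell n T x = cell n T y \<longleftrightarrow> same_side T x y"
proof
  assume "cell n T x = cell n T y"
  then have "y \<in> cell n T x" using cell_self[OF assms(2)] by simp
  then show "same_side T x y" by (simp add: cell_def)
qed (rule cell_eqI)

lemma cell_eq_if_mem: "y \<in> cell n T x \<Longrightarrow> cell n T x = cell n T y"
  by (intro cell_eqI) (simp add: cell_def)

lemma segment_below:
  fixes t :: real
  assumes "0 \<le> t" "t \<le> 1" "a < c" "b < c"
  shows "(1 - t) * a + t * b < c"
  by (rule convex_bound_lt) (use assms in auto)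

lemma segment_above:
  fixes t :: real
  assumes "0 \<le> t" "t \<le> 1" "c < a" "c < b"
  shows "c < (1 - t) * a + t * b"
  using segment_below[of t "- a" "- c" "- b"] assms by (simp add: algebra_simps)

text \<open>On a connected set that avoids the hyperplanes, the continuous function
  \<open>z i - z j\<close> has an interval as image and cannot cross \<open>c\<close>. Conversely,
  the segment between two points with the same signs stays off every hyperplane, since open
  half-spaces are convex.\<close>

lemma connected_component_of_generic:
  assumes T: "T \<subseteq> {1..n} \<times> {1..n} \<times> UNIV" and x: "x \<in> generic n T"
  shows "connected_component_of_set (subtopology (Rn n) (generic n T)) x = cell n T x"
proof (intro set_eqI iffI)
  fix y assume "y \<in> connected_component_of_set (subtopology (Rn n) (generic n T)) x"
  then obtain S where S: "connectedin (subtopology (Rn n) (generic n T)) S" "x \<in> S" "y \<in> S"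
    unfolding connected_component_of_def mem_Collect_eq by blast
  then have SG: "S \<subseteq> generic n T" and S': "connectedin (Rn n) S"
    by (auto simp: connectedin_subtopology)
  have "x i - x j < c \<longleftrightarrow> y i - y j < c" if "(i, j, c) \<in> T" for i j c
  proof -
    have ij: "i \<in> {1..n}" "j \<in> {1..n}" using T that by auto
    have "continuous_map (Rn n) euclideanreal (\<lambda>z. z i - z j)"
      using ij by (intro continuous_map_diff continuous_map_product_projection)
    from connectedin_continuous_map_image[OF this S']
    have "connected ((\<lambda>z. z i - z j) ` S)" by simp
    moreover have "c \<notin> (\<lambda>z. z i - z j) ` S" using SG that by (auto simp: generic_def)
    ultimately show ?thesis
      using S(2,3) unfolding connected_iff_interval
      by (smt (verit, ccfv_threshold) image_eqI)
  qed
  then show "y \<in> cell n T x" using S SG by (auto simp: cell_def same_side_def)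
next
  fix y assume y: "y \<in> cell n T x"
  \<comment> \<open>The segment from \<open>x\<close> to \<open>y\<close>. The restriction to
    \<open>{1..n}\<close> keeps it among extensional functions, so that its endpoints equal
    \<open>x\<close> and \<open>y\<close> as functions.\<close>
  define g where "g t = (\<lambda>i\<in>{1..n}. (1 - t) * x i + t * y i)" for t :: real
  have gd: "g t i - g t j = (1 - t) * (x i - x j) + t * (y i - y j)"
    if "(i, j, c) \<in> T" for t i j c
    using T that by (auto simp: g_def algebra_simps)
  have gT: "g t \<in> generic n T" if t: "t \<in> {0..1}" for t
  proof -
    have "g t i - g t j \<noteq> c" if m: "(i, j, c) \<in> T" for i j c
    proof (cases "x i - x j < c")
      case True
      then have "y i - y j < c" using y m by (auto simp: cell_def same_side_def)
      then show ?thesis using gd[OF m, of t] segment_below[of t "x i - x j" c "y i - y j"] True t by simp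
    next
      case False
      then have "c < x i - x j" "c < y i - y j"
        using x y m False by (auto simp: cell_def same_side_def generic_def order_less_le)
      then show ?thesis using gd[OF m, of t] segment_above[of t c "x i - x j" "y i - y j"] t by simp
    qed
    then show ?thesis by (auto simp: generic_def g_def)
  qed
  have "continuous_map (top_of_set {0..1}) (Rn n) g"
    unfolding continuous_map_componentwise
    by (auto simp: g_def intro!: continuous_intros)
  then have "continuous_map (top_of_set {0..1}) (subtopology (Rn n) (generic n T)) g"
    using gT by (auto simp: continuous_map_in_subtopology)
  then have "connectedin (subtopology (Rn n) (generic n T)) (g ` {0..1})"
    by (rule connectedin_continuous_map_image) (simp add: connectedin_subtopology)
  moreover have "g 0 = x" "g 1 = y"
    using x y by (auto simp: g_def cell_def generic_def PiE_def extensional_def fun_eq_iff)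
  then have "x \<in> g ` {0..1}" "y \<in> g ` {0..1}"
    by (metis atLeastAtMost_iff image_eqI order_refl zero_le_one)+
  ultimately show "y \<in> connected_component_of_set (subtopology (Rn n) (generic n T)) x"
    by (auto simp: connected_component_of_def)
qed

lemma regions_eq_cells:
  assumes T: "T \<subseteq> {1..n} \<times> {1..n} \<times> UNIV"
  shows "regions n ((\<lambda>(i, j, c). diff_hyperplane n i j c) ` T) = cell n T ` generic n T"
proof -
  have "topspace (Rn n) - \<Union> ((\<lambda>(i, j, c). diff_hyperplane n i j c) ` T) = generic n T"
    by (auto simp: generic_def diff_hyperplane_def)
  moreover have "topspace (subtopology (Rn n) (generic n T)) = generic n T"
    by (auto simp: generic_def)
  ultimately show ?thesis
    using connected_component_of_generic[OF T]
    by (auto simp: regions_def connected_components_of_def simp del: topspace_subtopology)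
qed

subsection \<open>Separation from the base region\<close>

definition shi_triples :: "nat \<Rightarrow> (nat \<times> nat \<times> real) set" where
  "shi_triples n = {(i, j, c). 1 \<le> i \<and> i < j \<and> j \<le> n \<and> (c = 0 \<or> c = 1)}"

lemma regions_shi: "regions n (shi_arrangement n) = cell n (shi_triples n) ` generic n (shi_triples n)"
proof -
  have "H \<in> shi_arrangement n \<longleftrightarrow> (\<exists>i j c. (i, j, c) \<in> shi_triples n \<and> H = diff_hyperplane n i j c)" for H
    unfolding shi_arrangement_def diff_hyperplanes_def shi_triples_def by blast
  then have "shi_arrangement n = (\<lambda>(i, j, c). diff_hyperplane n i j c) ` shi_triples n"
    unfolding set_eq_iff image_iff Bex_def split_paired_Ex prod.case by blast
  moreover have "shi_triples n \<subseteq> {1..n} \<times> {1..n} \<times> UNIV"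
    by (auto simp: shi_triples_def)
  ultimately show ?thesis by (simp add: regions_eq_cells)
qed

text \<open>Coordinates decrease, so each difference is positive and at most
  \<open>x 1 - x n\<close>, which is below 1.\<close>

lemma base_region_diff:
  assumes x: "x \<in> base_region n" and ij: "1 \<le> i" "i < j" "j \<le> n"
  shows "0 < x i - x j" "x i - x j < 1"
proof -
  have dec: "x b < x a" if "a < b" "1 \<le> a" "b \<le> n" for a b
    using that
  proof (induction b)
    case (Suc b)
    have *: "x (Suc b) < x b" using x Suc.prems by (auto simp: base_region_def)
    show ?case
    proof (cases "a = b")
      case False
      then show ?thesis using Suc * by force
    qed (use * in simp)
  qed simp
  have "x j < x i" using dec ij by blast
  moreover have "x i \<le> x 1" using dec[of 1 i] ij by (cases "i = 1") auto
  moreover have "x n \<le> x j" using dec[of j n] ij by (cases "j = n") auto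
  moreover have "x 1 - 1 < x n" using x by (simp add: base_region_def)
  ultimately show "0 < x i - x j" "x i - x j < 1" by auto
qed

lemma base_region_nonempty: "n \<ge> 1 \<Longrightarrow> base_region n \<noteq> {}"
proof -
  assume "n \<ge> 1"
  \<comment> \<open>Equally spaced decreasing coordinates of total spread
    \<open>(n - 1) / (n + 1)\<close>, which is below 1.\<close>
  then have "(\<lambda>i\<in>{1..n}. - real i / real (Suc n)) \<in> base_region n"
    by (auto simp: base_region_def field_simps)
  then show ?thesis by blast
qed

text \<open>The two sides of one hyperplane are the cells of a singleton \<open>T\<close>, so
  separation means that \<open>x\<close> and a base point have different cells. The base region
  satisfies \<open>z i - z j < c\<close> exactly when \<open>c\<close> is 1, that is, when
  \<open>0 < c\<close>.\<close>

lemma separates_base_region: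
  assumes x: "x \<in> generic n (shi_triples n)" and ijc: "(i, j, c) \<in> shi_triples n"
    and ne: "base_region n \<noteq> {}"
  shows "separates n (diff_hyperplane n i j c) (cell n (shi_triples n) x) (base_region n)
    \<longleftrightarrow> (x i - x j < c) \<noteq> (0 < c)"
proof -
  let ?T = "{(i, j, c)}"
  have ij: "1 \<le> i" "i < j" "j \<le> n" "c = 0 \<or> c = 1" using ijc by (auto simp: shi_triples_def)
  have reg: "regions n {diff_hyperplane n i j c} = cell n ?T ` generic n ?T"
    using regions_eq_cells[of ?T n] ij by auto
  obtain b where b: "b \<in> base_region n" using ne by blast
  have base: "z \<in> generic n ?T \<and> (z i - z j < c \<longleftrightarrow> 0 < c)" if "z \<in> base_region n" for z
    using base_region_diff[OF that ij(1-3)] ij(4) that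
    by (auto simp: generic_def base_region_def)
  have sub: "cell n (shi_triples n) x \<subseteq> cell n ?T x"
    using ijc by (auto simp: cell_def generic_def same_side_def)
  have xT: "x \<in> generic n ?T" using x ijc by (auto simp: generic_def)
  have baseT: "base_region n \<subseteq> cell n ?T b"
    using base b by (auto simp: cell_def same_side_def)
  have "separates n (diff_hyperplane n i j c) (cell n (shi_triples n) x) (base_region n)
    \<longleftrightarrow> cell n ?T x \<noteq> cell n ?T b"
  proof
    assume "separates n (diff_hyperplane n i j c) (cell n (shi_triples n) x) (base_region n)"
    then obtain u v where "cell n ?T u \<noteq> cell n ?T v" "x \<in> cell n ?T u" "b \<in> cell n ?T v"
      unfolding separates_def reg using cell_self[OF x] b by blast
    then show "cell n ?T x \<noteq> cell n ?T b" using cell_eq_if_mem by metis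
  next
    assume "cell n ?T x \<noteq> cell n ?T b"
    then show "separates n (diff_hyperplane n i j c) (cell n (shi_triples n) x) (base_region n)"
      unfolding separates_def reg using sub baseT xT base[OF b] by blast
  qed
  also have "\<dots> \<longleftrightarrow> \<not> same_side ?T x b" using cell_eq_iff xT base[OF b] by blast
  also have "\<dots> \<longleftrightarrow> (x i - x j < c) \<noteq> (0 < c)" using base[OF b] by (auto simp: same_side_def)
  finally show ?thesis .
qed

lemma diff_hyperplane_inj:
  assumes ij: "1 \<le> i" "i < j" "j \<le> n" and ij': "1 \<le> i'" "i' < j'" "j' \<le> n"
    and c: "0 \<le> c" and eq: "diff_hyperplane n i j c = diff_hyperplane n i' j' c"
  shows "i = i' \<and> j = j'"
proof -
  \<comment> \<open>A point on the first hyperplane chosen so that, for \<open>a < b\<close>, the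
    difference \<open>x a - x b\<close> is negative unless \<open>a = i\<close>, and for
    \<open>a = i\<close> it equals \<open>c\<close> only if \<open>b = j\<close>.\<close>
  define x where "x = (\<lambda>k\<in>{1..n}. if k = i then real j + c else real k)"
  have "x \<in> diff_hyperplane n i j c"
    using ij by (auto simp: diff_hyperplane_def x_def)
  then have "x \<in> diff_hyperplane n i' j' c" using eq by simp
  then have "x i' - x j' = c" by (simp add: diff_hyperplane_def)
  then show ?thesis using ij ij' c by (auto simp: x_def split: if_splits)
qed

text \<open>Passes from hyperplanes to index pairs, for both families at once: the last condition
  reads \<open>x i < x j\<close> for \<open>c = 0\<close> and \<open>x i - x j \<ge> 1\<close> for
  \<open>c = 1\<close>.\<close>

lemma card_separating:
  assumes x: "x \<in> generic n (shi_triples n)" and c: "c = 0 \<or> c = 1"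
    and ne: "base_region n \<noteq> {}"
  shows "card {H \<in> diff_hyperplanes n c. separates n H (cell n (shi_triples n) x) (base_region n)}
    = card {(i, j). 1 \<le> i \<and> i < j \<and> j \<le> n \<and> (x i - x j < c) \<noteq> (0 < c)}"
    (is "card ?L = card ?R")
proof -
  have "?L = (\<lambda>(i, j). diff_hyperplane n i j c) ` ?R"
    using separates_base_region[OF x _ ne, of _ _ c] c
    unfolding diff_hyperplanes_def shi_triples_def by (fastforce simp: image_iff)
  moreover have "inj_on (\<lambda>(i, j). diff_hyperplane n i j c) ?R"
  proof (rule inj_onI, clarsimp)
    fix i j i' j' assume "Suc 0 \<le> i" "i < j" "j \<le> n" "Suc 0 \<le> i'" "i' < j'" "j' \<le> n"
      and "diff_hyperplane n i j c = diff_hyperplane n i' j' c"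
    moreover have "0 \<le> c" using c by auto
    ultimately show "i = i' \<and> j = j'" using diff_hyperplane_inj by simp
  qed
  ultimately show ?thesis by (simp add: card_image)
qed

subsection \<open>Sorting permutations and ideals\<close>

definition sorts :: "nat \<Rightarrow> (nat \<Rightarrow> real) \<Rightarrow> (nat \<Rightarrow> nat) \<Rightarrow> bool" where
  "sorts n x \<pi> \<longleftrightarrow>
    \<pi> permutes {1..n} \<and> (\<forall>i j. 1 \<le> i \<and> i < j \<and> j \<le> n \<longrightarrow> x (\<pi> i) < x (\<pi> j))"

lemma sorts_permutes: "sorts n x \<pi> \<Longrightarrow> \<pi> permutes {1..n}"
  by (simp add: sorts_def)

lemma sorts_less_iff:
  assumes "sorts n x \<pi>" "i \<in> {1..n}" "j \<in> {1..n}"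
  shows "x (\<pi> i) < x (\<pi> j) \<longleftrightarrow> i < j"
proof -
  have *: "x (\<pi> a) < x (\<pi> b)" if "a < b" "a \<in> {1..n}" "b \<in> {1..n}" for a b
    using assms(1) that by (simp add: sorts_def)
  show ?thesis
    by (rule linorder_cases[of i j]) (use *[of i j] *[of j i] assms in auto)
qed

lemma permutes_obtain:
  assumes "\<pi> permutes S" "v \<in> S"
  obtains i where "i \<in> S" "\<pi> i = v"
proof -
  have "v \<in> \<pi> ` S" using assms by (simp add: permutes_image)
  then show ?thesis using that by (elim imageE) simp
qed

text \<open>Recovers a position from the point alone, as the rank of the coordinate found there.
  Distinctness of coordinates and uniqueness of the sorting permutation follow from this.\<close>

lemma sorts_rank:
  assumes s: "sorts n x \<pi>" and i: "i \<in> {1..n}"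
  shows "card {u \<in> {1..n}. x u \<le> x (\<pi> i)} = i"
proof -
  have p: "\<pi> permutes {1..n}" using s by (rule sorts_permutes)
  have "{u \<in> {1..n}. x u \<le> x (\<pi> i)} = \<pi> ` {1..i}"
  proof (intro set_eqI iffI)
    fix u assume u: "u \<in> {u \<in> {1..n}. x u \<le> x (\<pi> i)}"
    obtain a where a: "a \<in> {1..n}" "\<pi> a = u" by (rule permutes_obtain[OF p, of u]) (use u in auto)
    with u sorts_less_iff[OF s i, of a] show "u \<in> \<pi> ` {1..i}" by force
  next
    fix u assume "u \<in> \<pi> ` {1..i}"
    then obtain a where a: "u = \<pi> a" "a \<in> {1..i}" by blast
    then have "a \<in> {1..n}" using i by auto
    then show "u \<in> {u \<in> {1..n}. x u \<le> x (\<pi> i)}"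
      using a i sorts_less_iff[OF s i, of a] permutes_in_image[OF p, of a] by auto
  qed
  then show ?thesis using card_image[OF permutes_inj_on[OF p]] by simp
qed

lemma sorts_inj_on:
  assumes s: "sorts n x \<pi>"
  shows "inj_on x {1..n}"
proof (rule inj_onI)
  fix u v assume uv: "u \<in> {1..n}" "v \<in> {1..n}" "x u = x v"
  note p = sorts_permutes[OF s]
  obtain i where i: "i \<in> {1..n}" "\<pi> i = u" by (rule permutes_obtain[OF p, of u]) (use uv in auto)
  obtain j where j: "j \<in> {1..n}" "\<pi> j = v" by (rule permutes_obtain[OF p, of v]) (use uv in auto)
  show "u = v" using sorts_rank[OF s i(1)] sorts_rank[OF s j(1)] i j uv by simp
qed

lemma sorts_unique:
  assumes s: "sorts n x \<pi>" and t: "sorts n x \<sigma>"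
  shows "\<pi> = \<sigma>"
proof
  fix i
  note p = sorts_permutes[OF s] and q = sorts_permutes[OF t]
  show "\<pi> i = \<sigma> i"
  proof (cases "i \<in> {1..n}")
    case True
    then have "\<pi> i \<in> {1..n}" using permutes_in_image[OF p] by blast
    then obtain j where "j \<in> {1..n}" "\<sigma> j = \<pi> i" by (rule permutes_obtain[OF q])
    then show ?thesis using sorts_rank[OF s True] sorts_rank[OF t, of j] by simp
  next
    case False
    then show ?thesis using permutes_not_in p q by metis
  qed
qed

lemma sorts_exists:
  assumes inj: "inj_on x {1..n}"
  shows "\<exists>\<pi>. sorts n x \<pi>"
proof -
  \<comment> \<open>The rank sends a value to its position, so the sorting permutation is its
    inverse. Arguments outside \<open>{1..n}\<close> are fixed, as \<open>permutes\<close>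
    demands.\<close>
  define r where "r v = (if v \<in> {1..n} then card {u \<in> {1..n}. x u \<le> x v} else v)" for v
  have mono: "r v < r w" if "v \<in> {1..n}" "w \<in> {1..n}" "x v < x w" for v w
  proof -
    have "{u \<in> {1..n}. x u \<le> x v} \<subset> {u \<in> {1..n}. x u \<le> x w}" 
    proof
      show "{u \<in> {1..n}. x u \<le> x v} \<subseteq> {u \<in> {1..n}. x u \<le> x w}" using that by auto
      have "w \<notin> {u \<in> {1..n}. x u \<le> x v}" "w \<in> {u \<in> {1..n}. x u \<le> x w}" using that by auto
      then show "{u \<in> {1..n}. x u \<le> x v} \<noteq> {u \<in> {1..n}. x u \<le> x w}" by blast
    qed
    then show ?thesis using that by (simp add: r_def psubset_card_mono)
  qed
  have "inj_on r {1..n}"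
  proof (rule inj_onI)
    fix v w assume vw: "v \<in> {1..n}" "w \<in> {1..n}" "r v = r w"
    then have "x v = x w" using mono[of v w] mono[of w v] by force
    then show "v = w" using inj vw by (auto dest: inj_onD)
  qed
  moreover have "r v \<in> {1..n}" if v: "v \<in> {1..n}" for v
  proof -
    have "card {u \<in> {1..n}. x u \<le> x v} \<le> card {1..n}" by (rule card_mono) auto
    moreover have "card {u \<in> {1..n}. x u \<le> x v} \<noteq> 0" using v by auto
    ultimately have "r v \<noteq> 0 \<and> r v \<le> card {1..n}" unfolding r_def if_P[OF v] by blast
    then show ?thesis by simp
  qed
  then have "r ` {1..n} \<subseteq> {1..n}" by blast
  ultimately have "bij_betw r {1..n} {1..n}"
    by (simp add: bij_betw_def endo_inj_surj)
  then have r: "r permutes {1..n}" by (rule bij_imp_permutes) (auto simp: r_def)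
  have "x (inv r i) < x (inv r j)" if ij: "1 \<le> i" "i < j" "j \<le> n" for i j
  proof -
    have m: "inv r i \<in> {1..n}" "inv r j \<in> {1..n}"
      using permutes_in_image[OF permutes_inv[OF r]] ij by auto
    have e: "r (inv r i) = i" "r (inv r j) = j" using permutes_inverses(1)[OF r] by auto
    have "inv r i \<noteq> inv r j"
      using arg_cong[of "inv r i" "inv r j" r] unfolding e using ij by linarith
    then have "x (inv r i) \<noteq> x (inv r j)" using m inj by (auto dest: inj_onD)
    moreover have "\<not> x (inv r j) < x (inv r i)" using mono[OF m(2,1)] e ij by auto
    ultimately show ?thesis by simp
  qed
  then have "sorts n x (inv r)" using permutes_inv[OF r] by (simp add: sorts_def)
  then show ?thesis by blast
qed

text \<open>Order of positions is order of coordinates, so both sets can be read off the point. An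
  inversion lists the larger index first: \<open>(u, v)\<close> belongs to the hyperplanes of the
  pair \<open>v < u\<close>. Non-inversions are already in hyperplane order.\<close>

lemma sorts_inversions:
  assumes s: "sorts n x \<pi>"
  shows "perm_inversions n \<pi> = {(u, v). 1 \<le> v \<and> v < u \<and> u \<le> n \<and> x u < x v}" (is "_ = ?R")
    and "perm_noninversions n \<pi> = {(u, v). 1 \<le> u \<and> u < v \<and> v \<le> n \<and> x u < x v}" (is "_ = ?S")
proof -
  note p = sorts_permutes[OF s]
  have in1: "1 \<le> \<pi> i \<and> \<pi> i \<le> n" if "1 \<le> i" "i \<le> n" for i
    using permutes_in_image[OF p, of i] that by simp
  have pos: "\<exists>i j. u = \<pi> i \<and> v = \<pi> j \<and> 1 \<le> i \<and> i < j \<and> j \<le> n"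
    if uv: "u \<in> {1..n}" "v \<in> {1..n}" "x u < x v" for u v
  proof -
    obtain i where i: "i \<in> {1..n}" "\<pi> i = u" by (rule permutes_obtain[OF p, of u]) (use uv in auto)
    obtain j where j: "j \<in> {1..n}" "\<pi> j = v" by (rule permutes_obtain[OF p, of v]) (use uv in auto)
    show ?thesis using sorts_less_iff[OF s i(1) j(1)] i j uv by auto
  qed
  have lt: "x (\<pi> i) < x (\<pi> j)" if "1 \<le> i" "i < j" "j \<le> n" for i j
    using s that by (simp add: sorts_def)
  show "perm_inversions n \<pi> = ?R"
  proof (intro set_eqI iffI)
    fix g assume "g \<in> perm_inversions n \<pi>"
    then obtain i j where "g = (\<pi> i, \<pi> j)" "1 \<le> i" "i < j" "j \<le> n" "\<pi> j < \<pi> i"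
      by (auto simp: perm_inversions_def)
    then show "g \<in> ?R" using in1[of i] in1[of j] lt[of i j] by simp
  next
    fix g assume "g \<in> ?R"
    then obtain u v where g: "g = (u, v)" "1 \<le> v" "v < u" "u \<le> n" "x u < x v" by blast
    then obtain i j where "u = \<pi> i \<and> v = \<pi> j \<and> 1 \<le> i \<and> i < j \<and> j \<le> n"
      using pos[of u v] by auto
    with g show "g \<in> perm_inversions n \<pi>" unfolding perm_inversions_def by blast
  qed
  show "perm_noninversions n \<pi> = ?S"
  proof (intro set_eqI iffI)
    fix g assume "g \<in> perm_noninversions n \<pi>"
    then obtain i j where "g = (\<pi> i, \<pi> j)" "1 \<le> i" "i < j" "j \<le> n" "\<pi> i < \<pi> j"
      by (auto simp: perm_noninversions_def)
    then show "g \<in> ?S" using in1[of i] in1[of j] lt[of i j] by simp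
  next
    fix g assume "g \<in> ?S"
    then obtain u v where g: "g = (u, v)" "1 \<le> u" "u < v" "v \<le> n" "x u < x v" by blast
    then obtain i j where "u = \<pi> i \<and> v = \<pi> j \<and> 1 \<le> i \<and> i < j \<and> j \<le> n"
      using pos[of u v] by auto
    with g show "g \<in> perm_noninversions n \<pi>" unfolding perm_noninversions_def by blast
  qed
qed

section \<open>The ideal attached to a point\<close>

definition close_inversions :: "nat \<Rightarrow> (nat \<Rightarrow> real) \<Rightarrow> (nat \<times> nat) set" where
  "close_inversions n x = {(u, v). 1 \<le> v \<and> v < u \<and> u \<le> n \<and> x u < x v \<and> x v < x u + 1}"

text \<open>Shrinking an interval of positions can only shrink the gap between its end coordinates,
  because \<open>x\<close> increases along \<open>\<pi>\<close>.\<close>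

lemma close_inversions_ideal:
  assumes s: "sorts n x \<pi>"
  shows "IP_ideal n \<pi> (close_inversions n x)"
  unfolding IP_ideal_def sorts_inversions(1)[OF s]
proof (intro conjI ballI impI)
  show "close_inversions n x \<subseteq> {(u, v). 1 \<le> v \<and> v < u \<and> u \<le> n \<and> x u < x v}"
    by (auto simp: close_inversions_def)
next
  fix h g assume h: "h \<in> close_inversions n x"
    and g: "g \<in> {(u, v). 1 \<le> v \<and> v < u \<and> u \<le> n \<and> x u < x v}"
    and "IP_le n \<pi> g h"
  then obtain i j a b where ij: "{i, j, a, b} \<subseteq> {1..n}" "g = (\<pi> i, \<pi> j)" "h = (\<pi> a, \<pi> b)"
      "a \<le> i" "j \<le> b"
    unfolding IP_le_def by blast
  then have "x (\<pi> a) \<le> x (\<pi> i)" "x (\<pi> j) \<le> x (\<pi> b)"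
    using sorts_less_iff[OF s, of i a] sorts_less_iff[OF s, of b j] by auto
  moreover have "x (\<pi> b) < x (\<pi> a) + 1" using h ij(3) by (simp add: close_inversions_def)
  ultimately have "x (\<pi> j) < x (\<pi> i) + 1" by linarith
  then show "g \<in> close_inversions n x" using g ij(2) by (simp add: close_inversions_def)
qed

subsection \<open>Realizing an ideal\<close>

text \<open>Finds room for a new point between finitely many lower and upper bounds, either set of
  which may be empty.\<close>

lemma finite_separation:
  fixes L U :: "real set"
  assumes "finite L" "finite U" "\<And>a b. a \<in> L \<Longrightarrow> b \<in> U \<Longrightarrow> a < b"
  shows "\<exists>z. (\<forall>a\<in>L. a < z) \<and> (\<forall>b\<in>U. z < b)"
proof (cases "L = {} \<or> U = {}")
  case True
  moreover obtain z where "\<forall>b\<in>U. z < b"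
    using assms(2) by (metis Min_le lt_ex order_less_le_trans)
  moreover obtain w where "\<forall>a\<in>L. a < w"
    using assms(1) by (metis Max_ge gt_ex order_le_less_trans)
  ultimately show ?thesis by blast
next
  case False
  then have "Max L < Min U" using assms by simp
  then obtain z where "Max L < z" "z < Min U" using dense by blast
  then show ?thesis using assms(1,2) False by auto
qed

text \<open>
  A down-closed set \<open>J\<close> of intervals of positions is the indifference relation of a semiorder;
  the points are placed greedily from left to right.
\<close>

lemma unit_distance_representation:
  fixes J :: "nat \<Rightarrow> nat \<Rightarrow> bool"
  assumes J: "\<And>a b i j. J a b \<Longrightarrow> a \<le> i \<Longrightarrow> i < j \<Longrightarrow> j \<le> b \<Longrightarrow> J i j"
  shows "\<exists>y :: nat \<Rightarrow> real. \<forall>i j. i < j \<and> j < n \<longrightarrow>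
    y i < y j \<and> (if J i j then y j < y i + 1 else y i + 1 < y j)"
proof (induction n)
  case (Suc n)
  then obtain y :: "nat \<Rightarrow> real" where
    y: "\<And>i j. i < j \<Longrightarrow> j < n \<Longrightarrow> y i < y j \<and> (if J i j then y j < y i + 1 else y i + 1 < y j)"
    by blast
  \<comment> \<open>\<open>L\<close> holds the lower bounds on the new rightmost point: all earlier
    points, and \<open>y i + 1\<close> where the gap must exceed 1. \<open>U\<close> holds the upper
    bounds, from gaps that must stay below 1.\<close>
  define L where "L = y ` {..<n} \<union> (\<lambda>i. y i + 1) ` {i. i < n \<and> \<not> J i n}"
  define U where "U = (\<lambda>i. y i + 1) ` {i. i < n \<and> J i n}"
  have lt: "a < b" if ab: "a \<in> L" "b \<in> U" for a b
  proof -
    obtain m where m: "m < n" "J m n" "b = y m + 1" using ab(2) by (auto simp: U_def)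
    consider i where "i < n" "a = y i" | i where "i < n" "\<not> J i n" "a = y i + 1"
      using ab(1) by (auto simp: L_def)
    then show ?thesis
    proof cases
      case 1
      show ?thesis
      proof (cases "m < i")
        case True
        \<comment> \<open>Down-closure: the interval from \<open>m\<close> to \<open>i\<close> lies
          inside the close one from \<open>m\<close> to \<open>n\<close>.\<close>
        then have "J m i" using J[of m n m i] m 1 by simp
        then show ?thesis using y[of m i] True m 1 by simp
      next
        case False
        then have "y i \<le> y m" using y[of i m] m by (cases "i = m") auto
        then show ?thesis using 1 m by simp
      qed
    next
      case 2
      \<comment> \<open>Otherwise \<open>m \<le> i\<close>, and down-closure would turn
        \<open>J m n\<close> into \<open>J i n\<close>.\<close>
      have "i < m"
        using J[OF m(2), of i n] 2 by (meson leI order_refl)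
      then show ?thesis using y[of i m] m 2 by simp
    qed
  qed
  have "finite L" "finite U" by (auto simp: L_def U_def)
  then obtain z where z: "\<forall>a\<in>L. a < z" "\<forall>b\<in>U. z < b"
    using finite_separation lt by meson
  define y' where "y' = y(n := z)"
  have "y' i < y' j \<and> (if J i j then y' j < y' i + 1 else y' i + 1 < y' j)"
    if ij: "i < j" "j < Suc n" for i j
  proof (cases "j = n")
    case True
    have "y i < z" using z(1) ij True by (auto simp: L_def)
    moreover have "if J i n then z < y i + 1 else y i + 1 < z"
      using z ij True by (auto simp: L_def U_def)
    ultimately show ?thesis using True ij by (simp add: y'_def)
  next
    case False
    then show ?thesis using y[of i j] ij by (simp add: y'_def)
  qed
  then show ?case by blast
qed simp

lemma ideal_realizable:
  assumes p: "\<pi> permutes {1..n}" and I: "IP_ideal n \<pi> I"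
  obtains x where "x \<in> topspace (Rn n)" "sorts n x \<pi>" "close_inversions n x = I"
    "\<And>i j. i \<in> {1..n} \<Longrightarrow> j \<in> {1..n} \<Longrightarrow> x i - x j \<noteq> 1"
proof -
  \<comment> \<open>The ideal constrains inversions only, whereas the representation needs a
    decision for every pair of positions. An interval is declared long only if it contains an
    inversion outside \<open>I\<close>, which makes \<open>J\<close> down-closed.\<close>
  define J where "J i j \<longleftrightarrow> (\<forall>a b. i \<le> a \<and> a < b \<and> b \<le> j \<and> \<pi> b < \<pi> a \<longrightarrow> (\<pi> a, \<pi> b) \<in> I)" for i j
  \<comment> \<open>\<open>Suc n\<close> is used because positions run from 1 to \<open>n\<close>,
    while the representation starts at index 0.\<close>
  have "\<exists>y :: nat \<Rightarrow> real. \<forall>i j. i < j \<and> j < Suc n \<longrightarrow>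
      y i < y j \<and> (if J i j then y j < y i + 1 else y i + 1 < y j)"
    by (rule unit_distance_representation) (simp add: J_def)
  then obtain y :: "nat \<Rightarrow> real" where y: "\<And>i j. i < j \<Longrightarrow> j \<le> n \<Longrightarrow>
      y i < y j \<and> (if J i j then y j < y i + 1 else y i + 1 < y j)"
    unfolding less_Suc_eq_le by blast
  define x where "x = (\<lambda>v\<in>{1..n}. y (inv \<pi> v))"
  have x\<pi>: "x (\<pi> i) = y i" if "i \<in> {1..n}" for i
    using permutes_in_image[OF p, of i] permutes_inverses(2)[OF p] that by (simp add: x_def)
  have s: "sorts n x \<pi>" using p y x\<pi> by (simp add: sorts_def)
  have "x u - x v \<noteq> 1" if uv: "u \<in> {1..n}" "v \<in> {1..n}" for u v
  proof -
    obtain i where i: "i \<in> {1..n}" "\<pi> i = u" by (rule permutes_obtain[OF p, of u]) (use uv in auto)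
    obtain j where j: "j \<in> {1..n}" "\<pi> j = v" by (rule permutes_obtain[OF p, of v]) (use uv in auto)
    have "y i - y j \<noteq> 1"
    proof (cases "j < i")
      case True
      then show ?thesis using y[of j i] i by (auto split: if_splits)
    next
      case False
      then have "y i \<le> y j" using y[of i j] j by (cases "i = j") auto
      then show ?thesis by linarith
    qed
    then show ?thesis using x\<pi> i j by force
  qed
  moreover have "close_inversions n x = I"
  proof (intro set_eqI iffI)
    fix g assume g: "g \<in> close_inversions n x"
    then have "g \<in> perm_inversions n \<pi>"
      unfolding sorts_inversions(1)[OF s] by (auto simp: close_inversions_def)
    then obtain a b where ab: "g = (\<pi> a, \<pi> b)" "1 \<le> a" "a < b" "b \<le> n" "\<pi> b < \<pi> a"
      by (auto simp: perm_inversions_def)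
    have "y b < y a + 1" using g ab x\<pi>[of a] x\<pi>[of b] by (simp add: close_inversions_def)
    then have "J a b" using y[of a b] ab by (auto split: if_splits)
    then show "g \<in> I" using ab by (simp add: J_def)
  next
    fix g assume g: "g \<in> I"
    then have inv: "g \<in> perm_inversions n \<pi>" using I by (auto simp: IP_ideal_def)
    then obtain a b where ab: "g = (\<pi> a, \<pi> b)" "1 \<le> a" "a < b" "b \<le> n" "\<pi> b < \<pi> a"
      by (auto simp: perm_inversions_def)
    \<comment> \<open>Every inversion nested inside the positions of \<open>g\<close> is below
      \<open>g\<close> in the poset, so the ideal contains it.\<close>
    have "J a b" unfolding J_def
    proof (intro allI impI)
      fix i j assume ij: "a \<le> i \<and> i < j \<and> j \<le> b \<and> \<pi> j < \<pi> i"
      have "{i, j, a, b} \<subseteq> {1..n}" using ij ab by auto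
      then have "IP_le n \<pi> (\<pi> i, \<pi> j) g" unfolding IP_le_def using ij ab(1) by blast
      moreover have "1 \<le> i" "j \<le> n" using ij ab by auto
      then have "(\<pi> i, \<pi> j) \<in> perm_inversions n \<pi>" unfolding perm_inversions_def using ij by blast
      ultimately show "(\<pi> i, \<pi> j) \<in> I" using I g unfolding IP_ideal_def by blast
    qed
    then have "x (\<pi> b) < x (\<pi> a) + 1" using y[of a b] ab x\<pi>[of a] x\<pi>[of b] by simp
    then show "g \<in> close_inversions n x"
      using inv ab(1) unfolding sorts_inversions(1)[OF s] close_inversions_def by simp
  qed
  moreover have "x \<in> topspace (Rn n)" by (simp add: x_def)
  ultimately show ?thesis using that s by blast
qed

section \<open>Counting index pairs\<close>

lemma card_pairs: "card {(i, j). 1 \<le> i \<and> i < j \<and> j \<le> n} = n choose 2"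
proof -
  have "{(i, j). 1 \<le> i \<and> i < j \<and> j \<le> n} = prod.swap ` (SIGMA j:{1..n}. {1..<j})"
    by (auto simp: image_iff)
  then have "card {(i, j). 1 \<le> i \<and> i < j \<and> j \<le> n} = card (SIGMA j:{1..n}. {1..<j})"
    by (simp add: card_image)
  also have "\<dots> = (\<Sum>j = 1..n. j - 1)" by simp
  also have "\<dots> = n choose 2"
    by (induction n) (simp_all add: numeral_2_eq_2)
  finally show ?thesis .
qed

lemma finite_pairs: "finite {(i, j). 1 \<le> i \<and> i < j \<and> j \<le> (n::nat) \<and> P i j}"
  by (rule finite_subset[of _ "{1..n} \<times> {1..n}"]) auto

text \<open>For each pair, the parallel hyperplanes at 0 and 1 cut off three ranges of
  \<open>x i - x j\<close>: below 0, between 0 and 1, above 1. The middle range gives the close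
  inversions with their entries swapped.\<close>

lemma card_pairs_split:
  assumes x: "\<And>i j. 1 \<le> i \<Longrightarrow> i < j \<Longrightarrow> j \<le> n \<Longrightarrow> x i \<noteq> x j \<and> x i - x j \<noteq> 1"
  shows "card {(i, j). 1 \<le> i \<and> i < j \<and> j \<le> n \<and> x i < x j}
    + card {(i, j). 1 \<le> i \<and> i < j \<and> j \<le> n \<and> \<not> x i - x j < 1}
    + card (close_inversions n x) = n choose 2"
proof -
  let ?A = "{(i, j). 1 \<le> i \<and> i < j \<and> j \<le> n \<and> x i < x j}"
  let ?B = "{(i, j). 1 \<le> i \<and> i < j \<and> j \<le> n \<and> \<not> x i - x j < 1}"
  let ?C = "{(i, j). 1 \<le> i \<and> i < j \<and> j \<le> n \<and> x j < x i \<and> x i < x j + 1}"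
  have "close_inversions n x = prod.swap ` ?C"
    by (auto simp: close_inversions_def image_iff)
  then have C: "card (close_inversions n x) = card ?C" by (simp add: card_image)
  have "{(i, j). 1 \<le> i \<and> i < j \<and> j \<le> n} = (?A \<union> ?B) \<union> ?C"
    using x by force
  moreover have "card ((?A \<union> ?B) \<union> ?C) = card (?A \<union> ?B) + card ?C"
    by (intro card_Un_disjoint finite_UnI finite_pairs) auto
  moreover have "card (?A \<union> ?B) = card ?A + card ?B"
    by (intro card_Un_disjoint finite_UnI finite_pairs) auto
  ultimately show ?thesis using C card_pairs[of n] by simp
qed

subsection \<open>Counting regions\<close>

definition sorting_perm :: "nat \<Rightarrow> (nat \<Rightarrow> real) \<Rightarrow> nat \<Rightarrow> nat" where
  "sorting_perm n x = (THE \<pi>. sorts n x \<pi>)"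

lemma sorting_perm_eq: "sorts n x \<pi> \<Longrightarrow> sorting_perm n x = \<pi>"
  unfolding sorting_perm_def by (rule the_equality) (auto intro: sorts_unique)

lemma shi_generic:
  assumes "x \<in> generic n (shi_triples n)" "1 \<le> i" "i < j" "j \<le> n"
  shows "x i \<noteq> x j" "x i - x j \<noteq> 1"
proof -
  have "(i, j, 0) \<in> shi_triples n" "(i, j, 1) \<in> shi_triples n"
    using assms by (auto simp: shi_triples_def)
  then show "x i \<noteq> x j" "x i - x j \<noteq> 1"
    using assms(1) by (auto simp: generic_def)
qed

lemma shi_genericI:
  assumes "x \<in> topspace (Rn n)"
    and "\<And>i j. 1 \<le> i \<Longrightarrow> i < j \<Longrightarrow> j \<le> n \<Longrightarrow> x i \<noteq> x j \<and> x i - x j \<noteq> 1"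
  shows "x \<in> generic n (shi_triples n)"
  using assms by (auto simp: generic_def shi_triples_def)

lemma sorts_sorting_perm:
  assumes "x \<in> generic n (shi_triples n)"
  shows "sorts n x (sorting_perm n x)"
proof -
  have "inj_on x {1..n}"
    by (rule linorder_inj_onI) (use shi_generic(1)[OF assms] in auto)
  then obtain \<pi> where "sorts n x \<pi>" using sorts_exists by blast
  then show ?thesis using sorting_perm_eq by simp
qed

lemma same_side_shi_iff:
  "same_side (shi_triples n) x y \<longleftrightarrow> (\<forall>i j. 1 \<le> i \<longrightarrow> i < j \<longrightarrow> j \<le> n \<longrightarrow>
    (x i < x j \<longleftrightarrow> y i < y j) \<and> (x i - x j < 1 \<longleftrightarrow> y i - y j < 1))"
  (is "?L \<longleftrightarrow> ?R")
proof
  assume L: ?L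
  show ?R
  proof (intro allI impI)
    fix i j assume "1 \<le> i" "i < j" "j \<le> n"
    then have "(i, j, 0) \<in> shi_triples n" "(i, j, 1) \<in> shi_triples n"
      by (auto simp: shi_triples_def)
    then show "(x i < x j \<longleftrightarrow> y i < y j) \<and> (x i - x j < 1 \<longleftrightarrow> y i - y j < 1)"
      using L by (auto simp: same_side_def)
  qed
next
  assume R: ?R
  show ?L
    unfolding same_side_def
  proof (clarify)
    fix i j c assume "(i, j, c) \<in> shi_triples n"
    then have "1 \<le> i" "i < j" "j \<le> n" "c = 0 \<or> c = 1" by (auto simp: shi_triples_def)
    then show "x i - x j < c \<longleftrightarrow> y i - y j < c" using R by auto
  qed
qed

text \<open>The signs at 0 give the order of the coordinates, which is the same as the sorting
  permutation. Once these are fixed, the sign at 1 is in doubt only when \<open>x j < x i\<close>,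
  where it says whether \<open>(j, i)\<close> is a close inversion.\<close>

lemma cell_eq_iff_perm_ideal_eq:
  assumes x: "x \<in> generic n (shi_triples n)" and y: "y \<in> generic n (shi_triples n)"
  shows "cell n (shi_triples n) x = cell n (shi_triples n) y \<longleftrightarrow>
    (sorting_perm n x, close_inversions n x) = (sorting_perm n y, close_inversions n y)"
    (is "_ \<longleftrightarrow> ?F")
  unfolding cell_eq_iff[OF x y] same_side_shi_iff
proof
  assume H: "\<forall>i j. 1 \<le> i \<longrightarrow> i < j \<longrightarrow> j \<le> n \<longrightarrow>
    (x i < x j \<longleftrightarrow> y i < y j) \<and> (x i - x j < 1 \<longleftrightarrow> y i - y j < 1)"
  have ord: "x u < x v \<longleftrightarrow> y u < y v" if "u \<in> {1..n}" "v \<in> {1..n}" for u v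
  proof (cases u v rule: linorder_cases)
    case less
    then show ?thesis using H that by simp
  next
    case greater
    then have "x v < x u \<longleftrightarrow> y v < y u" "x v \<noteq> x u" "y v \<noteq> y u"
      using H that shi_generic(1)[OF x, of v u] shi_generic(1)[OF y, of v u] by auto
    then show ?thesis by linarith
  qed simp
  have s: "sorts n x (sorting_perm n x)" using x by (rule sorts_sorting_perm)
  then have "\<forall>i\<in>{1..n}. sorting_perm n x i \<in> {1..n}"
    using permutes_in_image[OF sorts_permutes[OF s]] by blast
  then have "sorts n y (sorting_perm n x)"
    using s ord by (simp add: sorts_def)
  then have "sorting_perm n y = sorting_perm n x" by (rule sorting_perm_eq)
  moreover have "(x u < x v \<and> x v < x u + 1) \<longleftrightarrow> (y u < y v \<and> y v < y u + 1)"
    if "1 \<le> v" "v < u" "u \<le> n" for u v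
  proof -
    have "x u < x v \<longleftrightarrow> y u < y v" using ord that by simp
    moreover have "x v - x u < 1 \<longleftrightarrow> y v - y u < 1" using H that by simp
    ultimately show ?thesis by linarith
  qed
  then have "close_inversions n x = close_inversions n y"
    unfolding close_inversions_def by blast
  ultimately show ?F by simp
next
  assume F: ?F
  define \<pi> where "\<pi> = sorting_perm n x"
  have sx: "sorts n x \<pi>" and sy: "sorts n y \<pi>"
    using sorts_sorting_perm[OF x] sorts_sorting_perm[OF y] F by (auto simp: \<pi>_def)
  have ord: "x u < x v \<longleftrightarrow> y u < y v" if uv: "u \<in> {1..n}" "v \<in> {1..n}" for u v
  proof -
    obtain i where i: "i \<in> {1..n}" "\<pi> i = u"
      by (rule permutes_obtain[OF sorts_permutes[OF sx], of u]) (use uv in auto)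
    obtain j where j: "j \<in> {1..n}" "\<pi> j = v"
      by (rule permutes_obtain[OF sorts_permutes[OF sx], of v]) (use uv in auto)
    show ?thesis using sorts_less_iff[OF sx i(1) j(1)] sorts_less_iff[OF sy i(1) j(1)] i j by simp
  qed
  show "\<forall>i j. 1 \<le> i \<longrightarrow> i < j \<longrightarrow> j \<le> n \<longrightarrow>
    (x i < x j \<longleftrightarrow> y i < y j) \<and> (x i - x j < 1 \<longleftrightarrow> y i - y j < 1)"
  proof (intro allI impI conjI)
    fix i j assume ij: "1 \<le> i" "i < j" "j \<le> n"
    show o1: "x i < x j \<longleftrightarrow> y i < y j" using ord[of i j] ij by simp
    have o2: "x j < x i \<longleftrightarrow> y j < y i" using ord[of j i] ij by simp
    have "(j, i) \<in> close_inversions n x \<longleftrightarrow> (j, i) \<in> close_inversions n y" using F by simp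
    then have "(x j < x i \<and> x i < x j + 1) \<longleftrightarrow> (y j < y i \<and> y i < y j + 1)"
      using ij by (simp add: close_inversions_def)
    then show "x i - x j < 1 \<longleftrightarrow> y i - y j < 1" using o1 o2 by linarith
  qed
qed

text \<open>Cells and pairs of permutation and ideal arise as images of the same set of points under
  maps with the same fibres. This compares their numbers without fixing representatives
  beforehand.\<close>

lemma bij_betw_images:
  assumes "\<And>x y. x \<in> A \<Longrightarrow> y \<in> A \<Longrightarrow> f x = f y \<longleftrightarrow> g x = g y"
  shows "\<exists>h. bij_betw h (f ` A) (g ` A)"
proof -
  define h where "h = g \<circ> inv_into A f"
  have "h (f x) = g x" if x: "x \<in> A" for x
  proof -
    have "f x \<in> f ` A" using x by (rule imageI)
    then have "inv_into A f (f x) \<in> A" "f (inv_into A f (f x)) = f x"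
      by (rule inv_into_into, rule f_inv_into_f)
    then show ?thesis using assms x by (simp add: h_def)
  qed
  moreover from this have "h ` f ` A = g ` A" by (simp add: image_image)
  ultimately have "bij_betw h (f ` A) (g ` A)"
    using assms by (simp add: bij_betw_def inj_on_def)
  then show ?thesis by blast
qed

lemma finite_perm_ideals: "finite (SIGMA \<pi>:{\<pi>. \<pi> permutes {1..n}}. {I. IP_ideal n \<pi> I})"
proof (intro finite_SigmaI)
  show "finite {\<pi>. \<pi> permutes {1..n}}" by (simp add: finite_permutations)
  fix \<pi> assume "\<pi> \<in> {\<pi>. \<pi> permutes {1..n}}"
  have "perm_inversions n \<pi> \<subseteq> (\<lambda>(i, j). (\<pi> i, \<pi> j)) ` ({1..n} \<times> {1..n})"
    by (auto simp: perm_inversions_def)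
  then have "finite (perm_inversions n \<pi>)" by (rule finite_subset) simp
  then have "finite (Pow (perm_inversions n \<pi>))" by simp
  moreover have "{I. IP_ideal n \<pi> I} \<subseteq> Pow (perm_inversions n \<pi>)" by (auto simp: IP_ideal_def)
  ultimately show "finite {I. IP_ideal n \<pi> I}" by (rule rev_finite_subset)
qed

text \<open>The second claim is additive, which avoids truncated subtraction on natural numbers. The
  bound on \<open>n\<close> makes the base region nonempty, as \<open>separates_base_region\<close>
  requires.\<close>

lemma dist_cell:
  assumes x: "x \<in> generic n (shi_triples n)" and n: "n \<ge> 1"
  shows "dist_a n (cell n (shi_triples n) x) = card (perm_noninversions n (sorting_perm n x))"
    and "card (perm_noninversions n (sorting_perm n x)) + dist_b n (cell n (shi_triples n) x)
      + card (close_inversions n x) = n choose 2"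
proof -
  note ne = base_region_nonempty[OF n]
  show a: "dist_a n (cell n (shi_triples n) x) = card (perm_noninversions n (sorting_perm n x))"
    unfolding dist_a_def sorts_inversions(2)[OF sorts_sorting_perm[OF x]]
    using card_separating[OF x _ ne, of 0] by simp
  have "dist_b n (cell n (shi_triples n) x) =
      card {(i, j). 1 \<le> i \<and> i < j \<and> j \<le> n \<and> \<not> x i - x j < 1}"
    unfolding dist_b_def using card_separating[OF x _ ne, of 1] by simp
  then show "card (perm_noninversions n (sorting_perm n x)) + dist_b n (cell n (shi_triples n) x)
      + card (close_inversions n x) = n choose 2"
    unfolding sorts_inversions(2)[OF sorts_sorting_perm[OF x]]
    using card_pairs_split[of n x] shi_generic[OF x] by simp
qed

text \<open>Regions correspond to certain pairs of a permutation and an ideal, of which there are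
  finitely many. Finiteness is what allows coefficients of the enumerator to be extracted, since a
  sum over an infinite set is 0 by convention.\<close>

lemma finite_regions_shi: "finite (regions n (shi_arrangement n))"
proof -
  let ?G = "generic n (shi_triples n)" and ?F = "\<lambda>x. (sorting_perm n x, close_inversions n x)"
  have "\<exists>h. bij_betw h (cell n (shi_triples n) ` ?G) (?F ` ?G)"
    by (rule bij_betw_images) (rule cell_eq_iff_perm_ideal_eq)
  then obtain h where h: "bij_betw h (cell n (shi_triples n) ` ?G) (?F ` ?G)" ..
  have "?F x \<in> (SIGMA \<pi>:{\<pi>. \<pi> permutes {1..n}}. {I. IP_ideal n \<pi> I})" if "x \<in> ?G" for x
    using sorts_permutes[OF sorts_sorting_perm[OF that]]
      close_inversions_ideal[OF sorts_sorting_perm[OF that]] by simp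
  then have "?F ` ?G \<subseteq> (SIGMA \<pi>:{\<pi>. \<pi> permutes {1..n}}. {I. IP_ideal n \<pi> I})" by blast
  then have "finite (?F ` ?G)" using finite_perm_ideals by (rule finite_subset)
  then show ?thesis using bij_betw_finite[OF h] by (simp add: regions_shi)
qed

lemma coeff_coeff_sum_monom:
  assumes "finite A"
  shows "coeff (coeff (\<Sum>r\<in>A. monom (monom (1::nat) (b r)) (a r)) k) l =
    card {r \<in> A. a r = k \<and> b r = l}"
proof -
  have "coeff (coeff (\<Sum>r\<in>A. monom (monom (1::nat) (b r)) (a r)) k) l =
      (\<Sum>r\<in>A. if a r = k \<and> b r = l then 1 else 0)"
    by (auto simp: coeff_sum intro!: sum.cong)
  also have "\<dots> = (\<Sum>r\<in>{r \<in> A. a r = k \<and> b r = l}. 1)"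
    using assms by (simp only: sum.inter_filter)
  finally show ?thesis by simp
qed

theorem theorem1:
  fixes n k l :: nat
  assumes "n \<ge> 2"
  shows "Dist n k l =
    (\<Sum>\<pi>\<in>perms_with_noninversions n k.
       num_IP_ideals n \<pi> (int (n choose 2) - int k - int l))"
proof -
  define m where "m = int (n choose 2) - int k - int l"
  let ?T = "shi_triples n"
  let ?F = "\<lambda>x. (sorting_perm n x, close_inversions n x)"
  \<comment> \<open>Points whose region contributes to the coefficient. The image of
    \<open>G\<close> under \<open>cell\<close> is the set of regions to be counted, its image under
    \<open>?F\<close> the set of pairs on the right-hand side.\<close>
  define G where "G = {x \<in> generic n ?T. dist_a n (cell n ?T x) = k \<and> dist_b n (cell n ?T x) = l}"
  let ?S = "SIGMA \<pi>:perms_with_noninversions n k. {I. IP_ideal n \<pi> I \<and> int (card I) = m}"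
  have n: "n \<ge> 1" using assms by simp
  \<comment> \<open>By \<open>dist_cell\<close>, once the number of non-inversions is
    \<open>k\<close>, the second distance is \<open>l\<close> exactly when the ideal has size
    \<open>m\<close>. As \<open>m\<close> is an integer, this also covers negative values, which no
    size attains.\<close>
  have G_iff: "x \<in> G \<longleftrightarrow> card (perm_noninversions n (sorting_perm n x)) = k
      \<and> int (card (close_inversions n x)) = m" if "x \<in> generic n ?T" for x
    using that dist_cell[OF that n] by (auto simp: G_def m_def)
  have "?F ` G = ?S"
  proof (intro equalityI subsetI)
    fix p assume "p \<in> ?F ` G"
    then obtain x where x: "p = ?F x" "x \<in> G" by blast
    then have xg: "x \<in> generic n ?T" by (simp add: G_def)
    note s = sorts_sorting_perm[OF xg]
    show "p \<in> ?S"
      using x G_iff[OF xg] sorts_permutes[OF s] close_inversions_ideal[OF s]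
      by (simp add: perms_with_noninversions_def)
  next
    fix p assume "p \<in> ?S"
    then obtain \<pi> I where p: "p = (\<pi>, I)" and pI: "\<pi> permutes {1..n}" "IP_ideal n \<pi> I"
      and cards: "card (perm_noninversions n \<pi>) = k" "int (card I) = m"
      by (auto simp: perms_with_noninversions_def)
    obtain x where x: "x \<in> topspace (Rn n)" "sorts n x \<pi>" "close_inversions n x = I"
      "\<And>i j. i \<in> {1..n} \<Longrightarrow> j \<in> {1..n} \<Longrightarrow> x i - x j \<noteq> 1"
      using ideal_realizable[OF pI] by blast
    have "x i \<noteq> x j" if "1 \<le> i" "i < j" "j \<le> n" for i j
      using sorts_inj_on[OF x(2)] that by (auto dest: inj_onD)
    then have xg: "x \<in> generic n ?T" using x(1,4) by (intro shi_genericI) auto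
    have "?F x = p" using p x(3) sorting_perm_eq[OF x(2)] by simp
    moreover have "x \<in> G" using G_iff[OF xg] p cards x(3) sorting_perm_eq[OF x(2)] by simp
    ultimately show "p \<in> ?F ` G" by blast
  qed
  moreover have "{R \<in> regions n (shi_arrangement n). dist_a n R = k \<and> dist_b n R = l} = cell n ?T ` G"
    by (auto simp: regions_shi G_def)
  moreover have "\<exists>h. bij_betw h (cell n ?T ` G) (?F ` G)"
    by (rule bij_betw_images, rule cell_eq_iff_perm_ideal_eq) (simp_all add: G_def)
  ultimately have "card {R \<in> regions n (shi_arrangement n). dist_a n R = k \<and> dist_b n R = l} = card ?S"
    using bij_betw_same_card by metis
  also have "card ?S = (\<Sum>\<pi>\<in>perms_with_noninversions n k. card {I. IP_ideal n \<pi> I \<and> int (card I) = m})"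
  proof (rule card_SigmaI)
    show "finite (perms_with_noninversions n k)"
      using finite_permutations[of "{1..n}"] unfolding perms_with_noninversions_def
      by (rule rev_finite_subset) auto
    show "\<forall>\<pi>\<in>perms_with_noninversions n k. finite {I. IP_ideal n \<pi> I \<and> int (card I) = m}"
    proof
      fix \<pi> assume "\<pi> \<in> perms_with_noninversions n k"
      \<comment> \<open>The ideals of one permutation embed as a fibre of the finite set of all
        pairs.\<close>
      then have "Pair \<pi> ` {I. IP_ideal n \<pi> I \<and> int (card I) = m}
          \<subseteq> (SIGMA \<pi>:{\<pi>. \<pi> permutes {1..n}}. {I. IP_ideal n \<pi> I})"
        by (auto simp: perms_with_noninversions_def)
      then have "finite (Pair \<pi> ` {I. IP_ideal n \<pi> I \<and> int (card I) = m})"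
        using finite_perm_ideals by (rule finite_subset)
      then show "finite {I. IP_ideal n \<pi> I \<and> int (card I) = m}"
        by (rule finite_imageD) (simp add: inj_on_def)
    qed
  qed
  finally show ?thesis
    unfolding Dist_def distance_enumerator_def coeff_coeff_sum_monom[OF finite_regions_shi]
      num_IP_ideals_def m_def .
qed

end
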